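(* Let $A|H$ and $B|K$ be conditional events ($H\neq\emptyset$, $K\neq\emptyset$), and let all the previsions involved form a coherent assessment. Then $$(A|H)\vee(B|K)+(A|H)\wedge(B|K)=A|H+B|K,$$ and hence $$\mathbb{P}[(A|H)\vee(B|K)]=\mathbb{P}(A|H)+\mathbb{P}(B|K)-\mathbb{P}[(A|H)\wedge(B|K)].$$
   Context: Events are identified with their indicators (value 1 if true, 0 if false); $\emptyset$ is the impossible event, $H^c$ the negation of $H$, juxtaposition denotes conjunction (product of indicators). A finite random quantity is a real quantity with finitely many possible values (a finitely-valued real function of the possible outcomes). Equality of random quantities means that they take the same value in every possible outcome. For an event $H\neq\emptyset$ and a finite random quantity $X$ with assessed conditional prevision $\mathbb{P}(X|H)=\mu\in\mathbb{R}$, the conditional random quantity $X|H$ is the random quantity $X|H = XH+\mu H^c$. For an event $A$ with $P(A|H)=\mathbb{P}(A|H)=x$ one has $A|H=AH+xH^c$. Conjunction: given $P(A|H)=x$, $P(B|K)=y$, the conjunction is the conditional random quantity $(A|H)\wedge(B|K)=\min\{A|H,B|K\}\,|\,(H\vee K)$, where $A|H=AH+xH^c$ and $B|K=BK+yK^c$. Negation of a conjunction: $[(A|H)\wedge(B|K)]^c=1-(A|H)\wedge(B|K)$. Disjunction: $(A|H)\vee(B|K)=[(A^c|H)\wedge(B^c|K)]^c$, which is the same as $\max\{A|H,B|K\}\,|\,(H\vee K)$. Coherence: a real function $\mathbb{P}$ on a family $\mathcal{K}$ of finite conditional random quantities is coherent iff for all $n\ge1$, all $X_1|H_1,\dots,X_n|H_n\in\mathcal{K}$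 and all real $s_1,\dots,s_n$, setting $\mu_i=\mathbb{P}(X_i|H_i)$ and $\mathcal{G}=\sum_{i=1}^n s_iH_i(X_i-\mu_i)$, the minimum and maximum of the values of $\mathcal{G}$ over the outcomes where $H_1\vee\cdots\vee H_n$ is true satisfy $\min\mathcal{G}\le 0\le\max\mathcal{G}$. *)

theory Defs
  imports Complex_Main "HOL-Library.Indicator_Function"
begin

text \<open>The possible outcomes are the elements of the type \<open>'w\<close>, events are sets of outcomes,
  and a conditional random quantity \<open>X|H\<close> is represented by the pair \<open>(X, H)\<close>. Its value depends
  on the assessed prevision and is given by \<open>crq_val\<close>.\<close>

type_synonym 'w crq = "('w \<Rightarrow> real) \<times> 'w set"

definition crq_val :: "('w crq \<Rightarrow> real) \<Rightarrow> 'w crq \<Rightarrow> 'w \<Rightarrow> real" where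
  "crq_val P c \<omega> = fst c \<omega> * indicator (snd c) \<omega> + P c * indicator (- snd c) \<omega>"

definition cond_event :: "'w set \<Rightarrow> 'w set \<Rightarrow> 'w crq" where
  "cond_event A H = (indicator A, H)"

definition gain :: "('w crq \<Rightarrow> real) \<Rightarrow> nat \<Rightarrow> (nat \<Rightarrow> 'w crq) \<Rightarrow> (nat \<Rightarrow> real) \<Rightarrow> 'w \<Rightarrow> real" where
  "gain P n c s \<omega> = (\<Sum>i<n. s i * indicator (snd (c i)) \<omega> * (fst (c i) \<omega> - P (c i)))"

text \<open>The first conjunct makes the minima and maxima below range over finite nonempty sets.
  Only the values of \<open>P\<close> on \<open>F\<close> matter.\<close>

definition coherent :: "('w crq \<Rightarrow> real) \<Rightarrow> 'w crq set \<Rightarrow> bool" where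
  "coherent P F \<longleftrightarrow>
     (\<forall>c\<in>F. finite (range (fst c)) \<and> snd c \<noteq> {}) \<and>
     (\<forall>n\<ge>1. \<forall>c s. (\<forall>i<n. c i \<in> F) \<longrightarrow>
        Min (gain P n c s ` (\<Union>i<n. snd (c i))) \<le> 0 \<and>
        0 \<le> Max (gain P n c s ` (\<Union>i<n. snd (c i))))"

definition crq_conj ::
  "('w crq \<Rightarrow> real) \<Rightarrow> 'w set \<Rightarrow> 'w set \<Rightarrow> 'w set \<Rightarrow> 'w set \<Rightarrow> 'w crq" where
  "crq_conj P A H B K =
     ((\<lambda>\<omega>. min (crq_val P (cond_event A H) \<omega>) (crq_val P (cond_event B K) \<omega>)), H \<union> K)"

text \<open>The negation \<open>1 - X|H\<close>, as a conditional random quantity, is \<open>(1 - X)|H\<close>: this is what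
  \<open>crq_val_neg\<close> below says. Likewise \<open>crq_disj_eq_max\<close> is the representation of the disjunction
  as a maximum.\<close>

definition crq_neg :: "'w crq \<Rightarrow> 'w crq" where
  "crq_neg c = ((\<lambda>\<omega>. 1 - fst c \<omega>), snd c)"

definition crq_disj ::
  "('w crq \<Rightarrow> real) \<Rightarrow> 'w set \<Rightarrow> 'w set \<Rightarrow> 'w set \<Rightarrow> 'w set \<Rightarrow> 'w crq" where
  "crq_disj P A H B K = crq_neg (crq_conj P (- A) H (- B) K)"

lemma coherent_const_gain:
  assumes "coherent P F" "n \<ge> 1" "\<And>i. i < n \<Longrightarrow> c i \<in> F"
    and const: "\<And>\<omega>. \<omega> \<in> (\<Union>i<n. snd (c i)) \<Longrightarrow> gain P n c s \<omega> = k"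
  shows "k = 0"
proof -
  have "snd (c 0) \<noteq> {}" using assms unfolding coherent_def by auto
  then have "(\<Union>i<n. snd (c i)) \<noteq> {}" using assms(2) by fastforce
  then have "gain P n c s ` (\<Union>i<n. snd (c i)) = {k}" using const by (force simp: image_def)
  moreover have "Min (gain P n c s ` (\<Union>i<n. snd (c i))) \<le> 0 \<and>
        0 \<le> Max (gain P n c s ` (\<Union>i<n. snd (c i)))"
    using assms(1-3) unfolding coherent_def by blast
  ultimately show ?thesis by simp
qed

lemma prevision_neg:
  assumes "coherent P F" "c \<in> F" "d \<in> F" "snd d = snd c"
    and "\<And>\<omega>. \<omega> \<in> snd c \<Longrightarrow> fst d \<omega> = 1 - fst c \<omega>"
  shows "P d = 1 - P c"
proof -
  let ?c = "\<lambda>i::nat. if i = 0 then c else d"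
  have "1 - P c - P d = 0"
  proof (rule coherent_const_gain[OF assms(1), where n = 2 and c = ?c and s = "\<lambda>_. 1"])
    fix \<omega> assume "\<omega> \<in> (\<Union>i<(2::nat). snd (?c i))"
    then have "\<omega> \<in> snd c" using assms(4) by (auto split: if_splits)
    then show "gain P 2 ?c (\<lambda>_. 1) \<omega> = 1 - P c - P d"
      using assms(4,5) by (simp add: gain_def numeral_2_eq_2)
  qed (use assms in auto)
  then show ?thesis by simp
qed

lemma crq_val_neg:
  assumes "coherent P F" "c \<in> F" "crq_neg c \<in> F"
  shows "crq_val P (crq_neg c) \<omega> = 1 - crq_val P c \<omega>"
proof -
  have "P (crq_neg c) = 1 - P c"
    by (rule prevision_neg[OF assms]) (auto simp: crq_neg_def)
  then show ?thesis by (auto simp: crq_val_def crq_neg_def indicator_def)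
qed

lemma crq_disj_eq_max:
  assumes "coherent P F"
    and "cond_event A H \<in> F" "cond_event (- A) H \<in> F"
    and "cond_event B K \<in> F" "cond_event (- B) K \<in> F"
  shows "crq_disj P A H B K =
     ((\<lambda>\<omega>. max (crq_val P (cond_event A H) \<omega>) (crq_val P (cond_event B K) \<omega>)), H \<union> K)"
proof -
  have "P (cond_event (- A) H) = 1 - P (cond_event A H)"
    by (rule prevision_neg[OF assms(1-3)]) (auto simp: cond_event_def indicator_def)
  then have 1: "crq_val P (cond_event (- A) H) \<omega> = 1 - crq_val P (cond_event A H) \<omega>" for \<omega>
    by (auto simp: crq_val_def cond_event_def indicator_def)
  have "P (cond_event (- B) K) = 1 - P (cond_event B K)"
    by (rule prevision_neg[OF assms(1,4,5)]) (auto simp: cond_event_def indicator_def)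
  then have 2: "crq_val P (cond_event (- B) K) \<omega> = 1 - crq_val P (cond_event B K) \<omega>" for \<omega>
    by (auto simp: crq_val_def cond_event_def indicator_def)
  show ?thesis
    by (auto simp: crq_disj_def crq_neg_def crq_conj_def 1 2 min_def max_def)
qed

end

theory Submission
  imports Defs
begin

text \<open>Write \<open>x\<close>, \<open>y\<close> for the previsions of \<open>A|H\<close> and \<open>B|K\<close>. Where \<open>H \<or> K\<close> is true, the disjunction
  and the conjunction take the larger and the smaller of the values of \<open>A|H\<close> and \<open>B|K\<close>, so the
  sum formula is \<open>max + min = sum\<close> (\<open>crq_disj_eq_max\<close> gives the representation as a maximum).
  Where \<open>H \<or> K\<close> is false, each of the four quantities equals its prevision, so there the sum
  formula is precisely the additivity of the previsions.

  That additivity is a Dutch book argument: bet on the disjunction and the conjunction and against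
  \<open>A|H\<close> and \<open>B|K\<close>, all with unit stake. A called-off bet pays nothing, so the gain from \<open>A|H\<close> is
  everywhere its value minus \<open>x\<close>, and likewise for \<open>B|K\<close>. By \<open>max + min = sum\<close> the values cancel
  on \<open>H \<or> K\<close>, and the total gain is a constant, the difference between the two sides of the
  prevision formula; coherence forces it to be \<open>0\<close> (\<open>coherent_const_gain\<close>).\<close>

lemma indicator_gain_eq_crq_val:
  "indicator (snd c) \<omega> * (fst c \<omega> - P c) = crq_val P c \<omega> - P c"
  by (simp add: crq_val_def indicator_def)

lemma crq_disj_plus_crq_conj_inside:
  assumes "coherent P F"
    and "cond_event A H \<in> F" "cond_event (- A) H \<in> F"
    and "cond_event B K \<in> F" "cond_event (- B) K \<in> F"
    and "\<omega> \<in> H \<union> K"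
  shows "crq_val P (crq_disj P A H B K) \<omega> + crq_val P (crq_conj P A H B K) \<omega>
       = crq_val P (cond_event A H) \<omega> + crq_val P (cond_event B K) \<omega>"
proof -
  let ?a = "crq_val P (cond_event A H) \<omega>" and ?b = "crq_val P (cond_event B K) \<omega>"
  have "crq_val P (crq_disj P A H B K) \<omega> = max ?a ?b"
    using assms(6) by (simp add: crq_disj_eq_max[OF assms(1-5)] crq_val_def[of P "(_, _)"])
  moreover have "crq_val P (crq_conj P A H B K) \<omega> = min ?a ?b"
    using assms(6) by (simp add: crq_conj_def crq_val_def[of P "(_, _)"])
  ultimately show ?thesis by simp
qed

lemma prevision_crq_disj:
  assumes "coherent P F"
    and "cond_event A H \<in> F" "cond_event (- A) H \<in> F"
    and "cond_event B K \<in> F" "cond_event (- B) K \<in> F"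
    and "crq_conj P A H B K \<in> F" "crq_disj P A H B K \<in> F"
  shows "P (crq_disj P A H B K)
       = P (cond_event A H) + P (cond_event B K) - P (crq_conj P A H B K)"
proof -
  let ?L = "[crq_disj P A H B K, crq_conj P A H B K, cond_event A H, cond_event B K]"
  let ?k = "P (cond_event A H) + P (cond_event B K)
              - P (crq_disj P A H B K) - P (crq_conj P A H B K)"
  have four: "{..<4} = {0, 1, 2, 3::nat}" by auto
  have "?k = 0"
  proof (rule coherent_const_gain[OF assms(1), where n = 4 and c = "(!) ?L"
        and s = "(!) [1, 1, - 1, - 1]"])
    fix i :: nat assume "i < 4"
    then have "i \<in> {0, 1, 2, 3}" using four by blast
    then show "?L ! i \<in> F" using assms by auto
  next
    fix \<omega> assume "\<omega> \<in> (\<Union>i<4. snd (?L ! i))"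
    then have "\<omega> \<in> H \<union> K"
      by (auto simp: four crq_disj_def crq_neg_def crq_conj_def cond_event_def)
    from crq_disj_plus_crq_conj_inside[OF assms(1-5) this]
    show "gain P 4 ((!) ?L) ((!) [1, 1, - 1, - 1]) \<omega> = ?k"
      by (simp add: gain_def four mult.assoc indicator_gain_eq_crq_val)
  qed simp
  then show ?thesis by simp
qed

theorem mainTheorem10:
  fixes P :: "'w crq \<Rightarrow> real" and A H B K :: "'w set"
  assumes "H \<noteq> {}" and "K \<noteq> {}"
    and "coherent P
      {cond_event A H, cond_event B K, cond_event (- A) H, cond_event (- B) K,
       crq_conj P A H B K, crq_conj P (- A) H (- B) K, crq_disj P A H B K}"
  shows "(\<forall>\<omega>. crq_val P (crq_disj P A H B K) \<omega> + crq_val P (crq_conj P A H B K) \<omega>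
            = crq_val P (cond_event A H) \<omega> + crq_val P (cond_event B K) \<omega>) \<and>
         P (crq_disj P A H B K)
            = P (cond_event A H) + P (cond_event B K) - P (crq_conj P A H B K)"
proof -
  have prev: "P (crq_disj P A H B K)
      = P (cond_event A H) + P (cond_event B K) - P (crq_conj P A H B K)"
    by (rule prevision_crq_disj[OF assms(3)]) auto
  have "crq_val P (crq_disj P A H B K) \<omega> + crq_val P (crq_conj P A H B K) \<omega>
      = crq_val P (cond_event A H) \<omega> + crq_val P (cond_event B K) \<omega>" for \<omega>
  proof (cases "\<omega> \<in> H \<union> K")
    case True
    then show ?thesis by (intro crq_disj_plus_crq_conj_inside[OF assms(3)]) auto
  next
    case False
    then have "crq_val P c \<omega> = P c" if "snd c \<in> {H, K, H \<union> K}" for c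
      using that by (auto simp: crq_val_def)
    moreover have "snd (crq_disj P A H B K) = H \<union> K" "snd (crq_conj P A H B K) = H \<union> K"
        "snd (cond_event A H) = H" "snd (cond_event B K) = K"
      by (simp_all add: crq_disj_def crq_neg_def crq_conj_def cond_event_def)
    ultimately show ?thesis using prev by simp
  qed
  with prev show ?thesis by blast
qed

end
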